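(* For every fixed $r \ge 1$, the function $$s \mapsto \theta_4(rs)\,\theta_4\!\left(\frac{r}{s}\right) - 2\,\theta_o(rs)\,\theta_o\!\left(\frac{r}{s}\right), \qquad s>0,$$ attains its maximum at $s = 1$.
   Context: For $s>0$, $\theta_4(s) = \sum_{k\in\mathbb{Z}} (-1)^k e^{-\pi k^2 s}$ and $\theta_o(s) = \sum_{k\in\mathbb{Z}} e^{-\pi (2k+1)^2 s}$. *)

theory Defs
  imports "HOL-Analysis.Analysis"
begin

definition theta4 :: "real \<Rightarrow> real" where
  "theta4 s = (\<Sum>\<^sub>\<infinity>k::int. (-1) powi k * exp (- pi * (of_int k)^2 * s))"

definition theta_o :: "real \<Rightarrow> real" where
  "theta_o s = (\<Sum>\<^sub>\<infinity>k::int. exp (- pi * (2 * of_int k + 1)^2 * s))"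

end

theory Submission
  imports Defs
begin

text \<open>
  Put \<open>X = pi r s\<close>, \<open>Y = pi r / s\<close>; by symmetry \<open>s \<ge> 1\<close>, so \<open>X \<ge> Y\<close>. Splitting the Gaussian sum into
  its even part \<open>E\<close> and its odd part \<open>O\<close> gives \<open>theta4 = E - O\<close> and \<open>theta_o = O\<close>.

  If \<open>exp (- Y) \<le> 1/8\<close>, the function decreases in \<open>s\<close>: with \<open>h(X) = - X O'(X) / (E + O)(X)\<close> and
  \<open>g(X) = - X E'(X) / (E - O)(X)\<close>, applying \<open>s d/ds\<close> to it gives
  \<open>(E - O)(X) (E - O)(Y) (g(Y) - g(X)) - (E + O)(X) (E + O)(Y) (h(Y) - h(X))\<close>, which is nonpositive
  because \<open>h\<close> and \<open>h - g\<close> are decreasing and \<open>E - O \<le> E + O\<close>. This is carried out for the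
  truncated sums, uniformly in the number of terms, so that only finite sums are differentiated.

  If \<open>exp (- Y) > 1/8\<close>, crude bounds suffice: the value at \<open>s\<close> is at most \<open>0.77\<close>, since
  \<open>theta4 (r / s)\<close> is, whereas the value at \<open>1\<close> is at least \<open>0.77\<close> because \<open>exp (- pi r) \<le> 1/20\<close>.
\<close>

section \<open>Truncated Gaussian sums over the odd and the even squares\<close>

definition expsum :: "(nat \<Rightarrow> real) \<Rightarrow> nat \<Rightarrow> nat \<Rightarrow> real \<Rightarrow> real" where
  "expsum c j n X = 2 * (\<Sum>k<n. c k ^ j * exp (- (c k * X)))"

definition oddsq :: "nat \<Rightarrow> real" where
  "oddsq k = (2 * real k + 1)\<^sup>2"

text \<open>Starts at 4: the square 0 comes from a single integer, so its term 1 is added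
  separately, while the factor 2 in \<open>expsum\<close> counts the two integers behind every other
  square.\<close>

definition evensq :: "nat \<Rightarrow> real" where
  "evensq k = (2 * real k + 2)\<^sup>2"

abbreviation "odd_sum \<equiv> expsum oddsq"
abbreviation "even_sum \<equiv> expsum evensq"

text \<open>Each differentiation brings down a factor \<open>- c k\<close>, so up to the sign
  \<open>(-1) ^ j\<close> the exponent \<open>j\<close> is the order of the derivative.\<close>

lemma DERIV_expsum [derivative_intros]:
  assumes "(f has_field_derivative f') (at x within A)"
  shows "((\<lambda>x. expsum c j n (f x)) has_field_derivative (- expsum c (Suc j) n (f x) * f')) (at x within A)"
  unfolding expsum_def
  by (auto intro!: derivative_eq_intros assms simp: sum_distrib_left sum_distrib_right sum_negf algebra_simps)

lemma expsum_nonneg: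
  assumes "\<And>k. c k \<ge> 0"
  shows "expsum c j n X \<ge> 0"
  unfolding expsum_def by (intro mult_nonneg_nonneg sum_nonneg) (auto simp: assms)

lemma oddsq_ge_1: "oddsq k \<ge> 1"
  by (simp add: oddsq_def power2_eq_square algebra_simps)

lemma evensq_nonneg: "evensq k \<ge> 0"
  by (simp add: evensq_def)

lemma odd_sum_nonneg: "odd_sum j n X \<ge> 0"
  by (rule expsum_nonneg) (simp add: oddsq_def)

lemma even_sum_nonneg: "even_sum j n X \<ge> 0"
  by (rule expsum_nonneg) (rule evensq_nonneg)

lemma odd_sum_mono_exponent: "odd_sum j n X \<le> odd_sum (Suc j) n X"
  unfolding expsum_def
proof (intro mult_left_mono sum_mono mult_right_mono)
  fix k show "oddsq k ^ j \<le> oddsq k ^ Suc j"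
    by (rule power_increasing) (auto simp: oddsq_ge_1)
qed auto

lemma odd_sum_lower:
  assumes "n \<ge> 1"
  shows "2 * exp (- X) \<le> odd_sum j n X"
proof -
  have "(\<Sum>k\<in>{0}. oddsq k ^ j * exp (- (oddsq k * X))) \<le> (\<Sum>k<n. oddsq k ^ j * exp (- (oddsq k * X)))"
    by (rule sum_mono2) (use assms oddsq_ge_1 order_trans[OF zero_le_one oddsq_ge_1] in auto)
  then show ?thesis by (simp add: expsum_def oddsq_def)
qed

text \<open>A geometric majorant of ratio 1/100 costs at most 100/99 < 1.05 times the leading term;
  the factor 2 in \<open>expsum\<close> turns 1.05 into 2.1.\<close>

lemma expsum_upper:
  fixes c :: "nat \<Rightarrow> real"
  assumes c: "\<And>k. c k \<ge> 0" "\<And>k. c k ^ j * exp (- (c k * X)) \<le> c 0 ^ j * exp (- (c 0 * X)) * (1/100) ^ k"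
  shows "expsum c j n X \<le> 2.1 * (c 0 ^ j * exp (- (c 0 * X)))"
proof -
  have "(\<Sum>k<n. c k ^ j * exp (- (c k * X))) \<le> (\<Sum>k<n. c 0 ^ j * exp (- (c 0 * X)) * (1/100) ^ k)"
    by (intro sum_mono c)
  also have "\<dots> = c 0 ^ j * exp (- (c 0 * X)) * (\<Sum>k<n. (1/100) ^ k)"
    by (simp add: sum_distrib_left)
  also have "(\<Sum>k<n. (1/100::real) ^ k) \<le> 1.05"
    by (subst sum_gp_strict) (simp add: field_simps)
  finally show ?thesis using c(1)[of 0] by (simp add: expsum_def mult_left_mono)
qed

lemma e_ge_2718: "exp 1 \<ge> (2.718::real)"
  using e_approx_32 by (simp add: abs_if split: if_splits)

text \<open>Since e^2 < 2.72^2 < 8, the hypothesis forces \<open>X \<ge> 2\<close>. From there on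
  \<open>exp (X - 2) \<ge> X - 1 \<ge> X / 2\<close>, which bounds \<open>X * exp (- X)\<close> by
  2/e^2 < 0.271.\<close>

lemma small_nome_imp:
  assumes "exp (- X) \<le> (1/8::real)"
  shows "X \<ge> 2" "X * exp (- X) \<le> 0.271"
proof -
  have e1: "exp (1::real) \<le> 2.72" using e_less_272 by simp
  have "exp (2::real) = exp 1 * exp 1" by (simp flip: exp_add)
  also have "\<dots> \<le> 2.72 * 2.72" using e1 by (intro mult_mono) auto
  finally have e2: "exp (2::real) \<le> 8" by simp
  have "exp X \<ge> 8" using assms by (simp add: exp_minus field_simps)
  then show X: "X \<ge> 2" using e2 by (metis exp_le_cancel_iff order_trans)
  have "exp (2::real) = exp 1 * exp 1" by (simp flip: exp_add)
  moreover have "\<dots> \<ge> 2.718 * 2.718" using e_ge_2718 by (intro mult_mono) auto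
  ultimately have e2': "exp (2::real) \<ge> 7.387" by simp
  have "exp (X - 2) \<ge> 1 + (X - 2)" by (rule exp_ge_add_one_self)
  then have "X \<le> 2 * exp (X - 2)" using X by simp
  also have "\<dots> = 2 * exp X / exp 2" by (simp add: exp_diff)
  also have "\<dots> \<le> 2 * exp X / 7.387" using e2' by (intro divide_left_mono) auto
  also have "\<dots> \<le> 0.271 * exp X" by simp
  finally show "X * exp (- X) \<le> 0.271" by (simp add: exp_minus field_simps)
qed

text \<open>Supplies the geometric decay of the tails: \<open>d\<close> will be the gap between the
  \<open>k\<close>-th and the leading square, and \<open>m\<close> will be 8.\<close>

lemma exp_neg_mult_le:
  assumes "exp (- X) \<le> (1/8::real)" "real m * real k \<le> d"
  shows "exp (- (d * X)) \<le> ((1/8) ^ m) ^ k"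
proof -
  have "X \<ge> 2" using small_nome_imp assms by auto
  then have "exp (- (d * X)) \<le> exp (- (real m * real k * X))"
    using assms by (simp add: mult_right_mono)
  also have "\<dots> = exp (- X) ^ (m * k)"
    by (simp add: exp_of_nat_mult[symmetric] mult.assoc)
  also have "\<dots> \<le> (1/8) ^ (m * k)"
    using assms by (intro power_mono) auto
  finally show ?thesis by (simp add: power_mult)
qed

lemma base_power_le: "real k + 1 \<le> 2 ^ k" "2 * real k + 1 \<le> 3 ^ k"
  by (induction k) simp_all

text \<open>The gap \<open>oddsq k - 1 = 4 * k * (k + 1)\<close> is at least \<open>8 * k\<close>,
  and the weight is at most 81^k, so the terms decay with ratio 81/8^8, well below 1/100.\<close>

lemma odd_sum_upper:
  assumes "exp (- X) \<le> 1/8" "j \<le> 2"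
  shows "odd_sum j n X \<le> 2.1 * exp (- X)"
proof -
  have "oddsq k ^ j * exp (- (oddsq k * X)) \<le> oddsq 0 ^ j * exp (- (oddsq 0 * X)) * (1/100) ^ k" for k
  proof -
    have "oddsq k ^ j \<le> oddsq k ^ 2" by (intro power_increasing oddsq_ge_1 assms)
    also have "\<dots> = (2 * real k + 1) ^ 4" by (simp add: oddsq_def)
    also have "\<dots> \<le> (3 ^ k) ^ 4" by (intro power_mono base_power_le) auto
    also have "\<dots> = 81 ^ k" by (subst power_mult[symmetric], subst mult.commute, subst power_mult) simp
    finally have 1: "oddsq k ^ j \<le> 81 ^ k" .
    have "exp (- ((oddsq k - 1) * X)) \<le> ((1/8) ^ 8) ^ k"
    proof (rule exp_neg_mult_le)
      have "real k \<le> real k * real k" by (cases k) (auto simp: field_simps)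
      then show "real 8 * real k \<le> oddsq k - 1" by (simp add: oddsq_def power2_eq_square algebra_simps)
    qed fact
    then have "oddsq k ^ j * exp (- ((oddsq k - 1) * X)) \<le> 81 ^ k * ((1/8) ^ 8) ^ k"
      using 1 by (intro mult_mono) auto
    also have "\<dots> = (81 * (1/8) ^ 8) ^ k" by (simp only: power_mult_distrib)
    also have "\<dots> \<le> (1/100) ^ k" by (intro power_mono) (auto simp: power_divide)
    finally have "exp (- X) * (oddsq k ^ j * exp (- ((oddsq k - 1) * X))) \<le> exp (- X) * (1/100) ^ k"
      by (intro mult_left_mono) auto
    moreover have "exp (- X) * exp (- ((oddsq k - 1) * X)) = exp (- (oddsq k * X))"
      by (simp add: algebra_simps flip: exp_add)
    ultimately have "oddsq k ^ j * exp (- (oddsq k * X)) \<le> exp (- X) * (1/100) ^ k"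
      by (metis mult.left_commute)
    moreover have "oddsq 0 = 1" by (simp add: oddsq_def)
    ultimately show ?thesis by simp
  qed
  moreover have "oddsq k \<ge> 0" for k using oddsq_ge_1[of k] by simp
  ultimately have "odd_sum j n X \<le> 2.1 * (oddsq 0 ^ j * exp (- (oddsq 0 * X)))"
    by (intro expsum_upper) auto
  then show ?thesis by (simp add: oddsq_def)
qed

text \<open>As for the odd squares: once 4^j is factored out, the weights are at most (k+1)^4 \<le>
  16^k, and the gap 4k^2 + 8k is again at least 8k.\<close>

lemma even_sum_upper:
  assumes "exp (- X) \<le> 1/8" "j \<le> 2"
  shows "even_sum j n X \<le> 2.1 * 4 ^ j * exp (- X) ^ 4"
proof -
  have "evensq k ^ j * exp (- (evensq k * X)) \<le> evensq 0 ^ j * exp (- (evensq 0 * X)) * (1/100) ^ k" for k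
  proof -
    have "(real k + 1)\<^sup>2 ^ j \<le> (real k + 1)\<^sup>2 ^ 2"
      by (intro power_increasing assms) auto
    also have "\<dots> = (real k + 1) ^ 4" by simp
    also have "\<dots> \<le> (2 ^ k) ^ 4" by (intro power_mono base_power_le) auto
    also have "\<dots> = 16 ^ k" by (subst power_mult[symmetric], subst mult.commute, subst power_mult) simp
    finally have 1: "(real k + 1)\<^sup>2 ^ j \<le> 16 ^ k" .
    have "exp (- ((evensq k - 4) * X)) \<le> ((1/8) ^ 8) ^ k"
      by (rule exp_neg_mult_le) (fact, simp add: evensq_def power2_eq_square algebra_simps)
    then have "(real k + 1)\<^sup>2 ^ j * exp (- ((evensq k - 4) * X)) \<le> 16 ^ k * ((1/8) ^ 8) ^ k"
      using 1 by (intro mult_mono) auto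
    also have "\<dots> = (16 * (1/8) ^ 8) ^ k" by (simp only: power_mult_distrib)
    also have "\<dots> \<le> (1/100) ^ k" by (intro power_mono) (auto simp: power_divide)
    finally have "4 ^ j * exp (- (4 * X)) * ((real k + 1)\<^sup>2 ^ j * exp (- ((evensq k - 4) * X)))
        \<le> 4 ^ j * exp (- (4 * X)) * (1/100) ^ k"
      by (intro mult_left_mono) auto
    moreover have "exp (- (4 * X)) * exp (- ((evensq k - 4) * X)) = exp (- (evensq k * X))"
      by (simp add: algebra_simps flip: exp_add)
    moreover have "4 ^ j * u * (v * w) = 4 ^ j * v * (u * w)" for u v w :: real
      by simp
    ultimately have "4 ^ j * (real k + 1)\<^sup>2 ^ j * exp (- (evensq k * X)) \<le> 4 ^ j * exp (- (4 * X)) * (1/100) ^ k"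
      by metis
    moreover have "evensq k ^ j = 4 ^ j * (real k + 1)\<^sup>2 ^ j"
      by (simp add: evensq_def power2_eq_square algebra_simps flip: power_mult_distrib)
    moreover have "evensq 0 = 4" by (simp add: evensq_def)
    ultimately show ?thesis by simp
  qed
  then have "even_sum j n X \<le> 2.1 * (evensq 0 ^ j * exp (- (evensq 0 * X)))"
    using evensq_nonneg by (intro expsum_upper) auto
  moreover have "exp (- (4 * X)) = exp (- X) ^ 4" using exp_of_nat_mult[of 4 "-X"] by simp
  ultimately show ?thesis by (simp add: evensq_def)
qed

section \<open>Monotonicity for small nomes\<close>

text \<open>The two slopes have different denominators because, in the derivative of the objective
  with respect to one argument, O' is multiplied (up to sign) by \<open>theta4 + 2 theta_o\<close>,
  that is E + O, at the other argument, but E' by \<open>theta4\<close>, that is E - O.\<close>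

definition odd_slope :: "nat \<Rightarrow> real \<Rightarrow> real" where
  "odd_slope n X = X * odd_sum 1 n X / (1 + even_sum 0 n X + odd_sum 0 n X)"

definition even_slope :: "nat \<Rightarrow> real \<Rightarrow> real" where
  "even_slope n X = X * even_sum 1 n X / (1 + even_sum 0 n X - odd_sum 0 n X)"

text \<open>The odd sum is at most 2.1/8 = 0.2625 and the even sum at most 2.1/8^4 < 0.0006.\<close>

lemma small_nome_bounds:
  assumes "exp (- X) \<le> 1/8"
  shows "1 + even_sum 0 n X - odd_sum 0 n X \<ge> 0.73" "1 + even_sum 0 n X + odd_sum 0 n X \<ge> 1" "1 + even_sum 0 n X + odd_sum 0 n X \<le> 1.264"
proof -
  have "exp (- X) ^ 4 \<le> (1/8) ^ 4" using assms by (intro power_mono) auto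
  then have "even_sum 0 n X \<le> 2.1 * (1/8)^4" using even_sum_upper[OF assms, of 0 n]
    by (simp add: power_divide)
  moreover have "odd_sum 0 n X \<le> 2.1 / 8" using odd_sum_upper[OF assms, of 0 n] assms by simp
  ultimately show "1 + even_sum 0 n X - odd_sum 0 n X \<ge> 0.73" "1 + even_sum 0 n X + odd_sum 0 n X \<ge> 1" "1 + even_sum 0 n X + odd_sum 0 n X \<le> 1.264"
    using even_sum_nonneg[of 0 n X] odd_sum_nonneg[of 0 n X] by (auto simp: power_numeral_reduce)
qed

text \<open>The term \<open>- X * odd_sum 2 n X\<close> dominates: with \<open>X \<ge> 2\<close> the
  numerator is at most \<open>odd_sum 1 n X * (1.58 - X)\<close>. The explicit margin
  \<open>0.5 * exp (- X)\<close> is what absorbs the derivative of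
  \<open>even_slope\<close>.\<close>

lemma DERIV_odd_slope:
  assumes "exp (- X) \<le> 1/8" "n \<ge> 1"
  shows "\<exists>D. (odd_slope n has_real_derivative D) (at X) \<and> D \<le> - (0.5 * exp (- X))"
proof -
  define a where "a = exp (- X)"
  define T where "T = 1 + even_sum 0 n X + odd_sum 0 n X"
  have a: "0 < a" "a \<le> 1/8" using assms by (auto simp: a_def)
  have X: "X \<ge> 2" "X * a \<le> 0.271" using small_nome_imp[OF assms(1)] by (auto simp: a_def)
  have T: "T \<ge> 1" "T \<le> 1.264" using small_nome_bounds[OF assms(1)] by (auto simp: T_def)
  define D where "D = ((odd_sum 1 n X - X * odd_sum 2 n X) * T + X * odd_sum 1 n X * (even_sum 1 n X + odd_sum 1 n X)) / T\<^sup>2"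
  have "((\<lambda>X. X * odd_sum 1 n X) has_real_derivative odd_sum 1 n X - X * odd_sum 2 n X) (at X)"
    by (rule derivative_eq_intros refl)+ (simp add: numeral_2_eq_2)
  moreover have "((\<lambda>X. 1 + even_sum 0 n X + odd_sum 0 n X) has_real_derivative - even_sum 1 n X - odd_sum 1 n X) (at X)"
    by (rule derivative_eq_intros refl)+ simp
  ultimately have "(odd_slope n has_real_derivative
      (((odd_sum 1 n X - X * odd_sum 2 n X) * T - X * odd_sum 1 n X * (- even_sum 1 n X - odd_sum 1 n X)) / (T * T))) (at X)"
    unfolding odd_slope_def[abs_def] T_def by (rule DERIV_divide) (use T in \<open>simp add: T_def\<close>)
  then have "(odd_slope n has_real_derivative D) (at X)"
    by (rule DERIV_cong) (simp add: D_def power2_eq_square algebra_simps)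
  moreover have "D \<le> - (0.5 * a)"
  proof -
    have "odd_sum 1 n X \<le> odd_sum 2 n X" using odd_sum_mono_exponent[of 1 n X] by (simp add: numeral_2_eq_2)
    then have "X * odd_sum 1 n X \<le> X * odd_sum 2 n X" using X by simp
    then have "(odd_sum 1 n X - X * odd_sum 2 n X) * T \<le> (odd_sum 1 n X * (1 - X)) * T"
      using T by (intro mult_right_mono) (auto simp: algebra_simps)
    also have "\<dots> = odd_sum 1 n X * ((1 - X) * T)" by simp
    also have "(1 - X) * T \<le> (1 - X) * 1" using X T by (intro mult_left_mono_neg) auto
    then have "odd_sum 1 n X * ((1 - X) * T) \<le> odd_sum 1 n X * (1 - X)" using odd_sum_nonneg by (intro mult_left_mono) auto
    finally have 1: "(odd_sum 1 n X - X * odd_sum 2 n X) * T \<le> odd_sum 1 n X * (1 - X)" .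
    have "a ^ 4 = a * a ^ 3" by (simp add: power_numeral_reduce)
    also have "\<dots> \<le> a * (1/8) ^ 3" using a by (intro mult_left_mono power_mono) auto
    finally have a4: "a ^ 4 \<le> a / 512" by (simp add: power_numeral_reduce)
    \<comment> \<open>The even sum is at most 8.4 a^4 \<le> 8.4 a / 512 < 0.02 a.\<close>
    have "even_sum 1 n X + odd_sum 1 n X \<le> 2.12 * a"
      using even_sum_upper[OF assms(1), of 1 n] odd_sum_upper[OF assms(1), of 1 n] a4 a by (simp add: a_def[symmetric])
    then have "X * (even_sum 1 n X + odd_sum 1 n X) \<le> X * (2.12 * a)" using X by (intro mult_left_mono) auto
    also have "\<dots> \<le> 0.58" using X by simp
    finally have "odd_sum 1 n X * (X * (even_sum 1 n X + odd_sum 1 n X)) \<le> odd_sum 1 n X * 0.58"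
      using odd_sum_nonneg by (intro mult_left_mono) auto
    with 1 have "(odd_sum 1 n X - X * odd_sum 2 n X) * T + X * odd_sum 1 n X * (even_sum 1 n X + odd_sum 1 n X) \<le> odd_sum 1 n X * (1.58 - X)"
      by (simp add: algebra_simps)
    also have "\<dots> \<le> odd_sum 1 n X * (-0.42)" using X odd_sum_nonneg by (intro mult_left_mono) auto
    also have "\<dots> \<le> - (0.84 * a)" using odd_sum_lower[OF assms(2), of X 1] by (simp add: a_def)
    \<comment> \<open>Dividing by the squared denominator, at most 1.6, still leaves 0.84/1.6 >
      0.5.\<close>
    also have "- (0.84 * a) \<le> - (0.5 * a) * T\<^sup>2"
    proof -
      have "T\<^sup>2 \<le> 1.264\<^sup>2" using T by (intro power_mono) auto
      then have "T\<^sup>2 \<le> 1.6" by (simp add: power2_eq_square)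
      then have "a * T\<^sup>2 \<le> a * 1.6" using a by (intro mult_left_mono) auto
      then show ?thesis using a by simp
    qed
    finally show ?thesis using T by (simp add: D_def divide_le_eq)
  qed
  ultimately show ?thesis by (auto simp: a_def)
qed

text \<open>The even sums are of order a^4 with \<open>a = exp (- X)\<close>. Pairing one
  \<open>a\<close> with \<open>X\<close> via \<open>X * a \<le> 0.271\<close> makes the negative
  terms small multiples of \<open>a\<close>; the nonnegative terms are discarded.\<close>

lemma DERIV_even_slope:
  assumes "exp (- X) \<le> 1/8"
  shows "\<exists>D. (even_slope n has_real_derivative D) (at X) \<and> D \<ge> - (0.5 * exp (- X))"
proof -
  define a where "a = exp (- X)"
  define T where "T = 1 + even_sum 0 n X - odd_sum 0 n X"
  have a: "0 < a" "a \<le> 1/8" using assms by (auto simp: a_def)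
  have X: "X \<ge> 2" "X * a \<le> 0.271" using small_nome_imp[OF assms(1)] by (auto simp: a_def)
  have T: "T \<ge> 0.73" using small_nome_bounds[OF assms(1)] by (auto simp: T_def)
  define D where "D = ((even_sum 1 n X - X * even_sum 2 n X) * T + X * even_sum 1 n X * (even_sum 1 n X - odd_sum 1 n X)) / T\<^sup>2"
  have "((\<lambda>X. X * even_sum 1 n X) has_real_derivative even_sum 1 n X - X * even_sum 2 n X) (at X)"
    by (rule derivative_eq_intros refl)+ (simp add: numeral_2_eq_2)
  moreover have "((\<lambda>X. 1 + even_sum 0 n X - odd_sum 0 n X) has_real_derivative - even_sum 1 n X + odd_sum 1 n X) (at X)"
    by (rule derivative_eq_intros refl)+ simp
  ultimately have "(even_slope n has_real_derivative
      (((even_sum 1 n X - X * even_sum 2 n X) * T - X * even_sum 1 n X * (- even_sum 1 n X + odd_sum 1 n X)) / (T * T))) (at X)"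
    unfolding even_slope_def[abs_def] T_def by (rule DERIV_divide) (use T in \<open>simp add: T_def\<close>)
  then have "(even_slope n has_real_derivative D) (at X)"
    by (rule DERIV_cong) (simp add: D_def power2_eq_square algebra_simps)
  moreover have "D \<ge> - (1/2 * a)"
  proof -
    have a3: "a ^ 3 \<le> (1/8) ^ 3" "a ^ 2 \<le> (1/8) ^ 2" using a by (auto intro!: power_mono)
    have "X * even_sum 2 n X \<le> X * (33.6 * a ^ 4)"
      using even_sum_upper[OF assms(1), of 2 n] X by (intro mult_left_mono) (auto simp: a_def)
    also have "\<dots> = 33.6 * (X * a) * (a * a ^ 2)" by (simp add: power_numeral_reduce)
    also have "\<dots> \<le> 33.6 * 0.271 * (a * (1/8) ^ 2)"
      using X a a3 by (intro mult_mono mult_left_mono) auto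
    finally have 1: "X * even_sum 2 n X \<le> 3/20 * a" using a by (simp add: power2_eq_square)
    have "X * even_sum 1 n X * odd_sum 1 n X \<le> X * (8.4 * a ^ 4) * (2.1 * a)"
      using even_sum_upper[OF assms(1), of 1 n] odd_sum_upper[OF assms(1), of 1 n] X odd_sum_nonneg
      by (intro mult_mono mult_left_mono mult_nonneg_nonneg) (auto simp: a_def)
    also have "\<dots> = 17.64 * (X * a) * (a * a ^ 3)" by (simp add: power_numeral_reduce)
    also have "\<dots> \<le> 17.64 * 0.271 * (a * (1/8) ^ 3)"
      using X a a3 by (intro mult_mono mult_left_mono) auto
    finally have 2: "X * even_sum 1 n X * odd_sum 1 n X \<le> 1/100 * a" using a by (simp add: power_numeral_reduce)
    have "3/20 * a * (73/100) \<le> 3/20 * a * T" using a T by (intro mult_left_mono) auto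
    moreover have "X * even_sum 2 n X * T \<le> 3/20 * a * T" using 1 T by (intro mult_right_mono) auto
    moreover have "even_sum 1 n X * T \<ge> 0" "X * even_sum 1 n X * even_sum 1 n X \<ge> 0" using even_sum_nonneg X T by auto
    moreover have "(even_sum 1 n X - X * even_sum 2 n X) * T + X * even_sum 1 n X * (even_sum 1 n X - odd_sum 1 n X)
        = even_sum 1 n X * T - X * even_sum 2 n X * T + X * even_sum 1 n X * even_sum 1 n X - X * even_sum 1 n X * odd_sum 1 n X"
      by (simp add: algebra_simps)
    ultimately have "(even_sum 1 n X - X * even_sum 2 n X) * T + X * even_sum 1 n X * (even_sum 1 n X - odd_sum 1 n X) \<ge> - (3/10 * a * T)"
      using 2 a by linarith
    \<comment> \<open>Since \<open>T \<ge> 0.73\<close>, half of \<open>a * T\<^sup>2\<close> is at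
      least \<open>0.365 * a * T\<close>, which exceeds the loss
      \<open>3/10 * a * T\<close>.\<close>
    moreover have "1/2 * a * (73/100 * T) \<le> 1/2 * a * T\<^sup>2"
      using a T unfolding power2_eq_square by (intro mult_left_mono mult_right_mono) auto
    moreover have "0 \<le> a * T" using a T by simp
    ultimately have "(even_sum 1 n X - X * even_sum 2 n X) * T + X * even_sum 1 n X * (even_sum 1 n X - odd_sum 1 n X) \<ge> - (1/2 * a) * T\<^sup>2"
      by (simp only: mult.assoc mult.left_commute[of T])
    then show ?thesis using T by (simp add: D_def pos_le_divide_eq)
  qed
  ultimately show ?thesis by (auto simp: a_def)
qed

lemma odd_slope_antimono:
  assumes "exp (- Y) \<le> 1/8" "Y \<le> X" "n \<ge> 1"
  shows "odd_slope n X \<le> odd_slope n Y"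
proof (rule DERIV_nonpos_imp_nonincreasing[OF assms(2)])
  fix x assume "Y \<le> x" "x \<le> X"
  then have "exp (- x) \<le> 1/8" using assms(1) by (smt (verit) exp_le_cancel_iff)
  from DERIV_odd_slope[OF this assms(3)]
  obtain D where "(odd_slope n has_real_derivative D) (at x)" "D \<le> - (0.5 * exp (- x))" by blast
  moreover have "- (0.5 * exp (- x)) \<le> 0" by simp
  ultimately show "\<exists>y. (odd_slope n has_real_derivative y) (at x) \<and> y \<le> 0"
    using order_trans by blast
qed

text \<open>The value \<open>- (0.5 * exp (- x))\<close> separates the derivatives: that of
  \<open>odd_slope\<close> lies below it, that of \<open>even_slope\<close> above.\<close>

lemma odd_minus_even_slope_antimono:
  assumes "exp (- Y) \<le> 1/8" "Y \<le> X" "n \<ge> 1"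
  shows "odd_slope n X - even_slope n X \<le> odd_slope n Y - even_slope n Y"
proof (rule DERIV_nonpos_imp_nonincreasing[OF assms(2), where f = "\<lambda>x. odd_slope n x - even_slope n x"])
  fix x assume "Y \<le> x" "x \<le> X"
  then have "exp (- x) \<le> 1/8" using assms(1) by (smt (verit) exp_le_cancel_iff)
  from DERIV_odd_slope[OF this assms(3)] DERIV_even_slope[OF this, of n] 
  obtain D D' where "(odd_slope n has_real_derivative D) (at x)" "(even_slope n has_real_derivative D') (at x)" "D - D' \<le> 0"
    by fastforce
  then show "\<exists>y. ((\<lambda>x. odd_slope n x - even_slope n x) has_real_derivative y) (at x) \<and> y \<le> 0"
    by (metis DERIV_diff)
qed

section \<open>Monotonicity of the truncated objective\<close>

definition objective_partial :: "nat \<Rightarrow> real \<Rightarrow> real \<Rightarrow> real" where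
  "objective_partial n X Y = (1 + even_sum 0 n X - odd_sum 0 n X) * (1 + even_sum 0 n Y - odd_sum 0 n Y) - 2 * odd_sum 0 n X * odd_sum 0 n Y"

text \<open>The left side is \<open>s\<close> times the derivative of
  \<open>objective_partial n X Y\<close> along \<open>X = \<rho> * s\<close>,
  \<open>Y = \<rho> / s\<close>.\<close>

lemma objective_partial_deriv_sign:
  assumes "exp (- Y) \<le> 1/8" "Y \<le> X" "n \<ge> 1"
  shows "X * (odd_sum 1 n X - even_sum 1 n X) * (1 + even_sum 0 n Y - odd_sum 0 n Y) - (1 + even_sum 0 n X - odd_sum 0 n X) * (Y * (odd_sum 1 n Y - even_sum 1 n Y))
       + 2 * (X * odd_sum 1 n X) * odd_sum 0 n Y - 2 * odd_sum 0 n X * (Y * odd_sum 1 n Y) \<le> 0" (is "?L \<le> 0")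
proof -
  define S T where "S = (\<lambda>X. 1 + even_sum 0 n X + odd_sum 0 n X)" and "T = (\<lambda>X. 1 + even_sum 0 n X - odd_sum 0 n X)"
  have X: "exp (- X) \<le> 1/8" using assms by (smt (verit) exp_le_cancel_iff)
  note bd = small_nome_bounds[OF X, of n] small_nome_bounds[OF assms(1), of n]
  have pos: "S X > 0" "S Y > 0" "T X > 0" "T Y > 0" using bd by (auto simp: S_def T_def)
  have le: "T X \<le> S X" "T Y \<le> S Y" using odd_sum_nonneg[of 0 n] by (auto simp: S_def T_def)
  have h: "X * odd_sum 1 n X = odd_slope n X * S X" "Y * odd_sum 1 n Y = odd_slope n Y * S Y"
    using pos by (auto simp: odd_slope_def S_def)
  have g: "X * even_sum 1 n X = even_slope n X * T X" "Y * even_sum 1 n Y = even_slope n Y * T Y"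
    using pos by (auto simp: even_slope_def T_def)
  have "?L = X * odd_sum 1 n X * S Y - X * even_sum 1 n X * T Y - S X * (Y * odd_sum 1 n Y) + T X * (Y * even_sum 1 n Y)"
    by (simp add: S_def T_def algebra_simps)
  also have "\<dots> = T X * T Y * (even_slope n Y - even_slope n X) - S X * S Y * (odd_slope n Y - odd_slope n X)"
    unfolding h g by (simp add: algebra_simps)
  \<comment> \<open>First the increment of the even slope is replaced by the larger one of the odd
    slope; as that is nonnegative, the factor \<open>T X * T Y\<close> may then grow to
    \<open>S X * S Y\<close>.\<close>
  also have "T X * T Y * (even_slope n Y - even_slope n X) \<le> T X * T Y * (odd_slope n Y - odd_slope n X)"
    using odd_minus_even_slope_antimono[OF assms] pos by (intro mult_left_mono) auto
  also have "T X * T Y * (odd_slope n Y - odd_slope n X) \<le> S X * S Y * (odd_slope n Y - odd_slope n X)"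
    using odd_slope_antimono[OF assms] pos le by (intro mult_right_mono mult_mono) auto
  finally show ?thesis by simp
qed

lemma objective_partial_le_diag:
  assumes "\<rho> > 0" "s \<ge> 1" "exp (- (\<rho> / s)) \<le> 1/8" "n \<ge> 1"
  shows "objective_partial n (\<rho> * s) (\<rho> / s) \<le> objective_partial n \<rho> \<rho>"
proof -
  have "objective_partial n (\<rho> * s) (\<rho> / s) \<le> objective_partial n (\<rho> * 1) (\<rho> / 1)"
  proof (rule DERIV_nonpos_imp_nonincreasing[OF assms(2), where f = "\<lambda>s. objective_partial n (\<rho> * s) (\<rho> / s)"])
    fix x assume x: "1 \<le> x" "x \<le> s"
    define X Y where "X = \<rho> * x" and "Y = \<rho> / x"
    \<comment> \<open>The nome \<open>exp (- (\<rho> / x))\<close> grows with \<open>x\<close>, so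
      its bound at the endpoint \<open>s\<close> covers the whole interval.\<close>
    have "\<rho> / s \<le> Y" using x assms(1) unfolding Y_def by (intro divide_left_mono) auto
    then have Y: "exp (- Y) \<le> 1/8" using assms(3) by (smt (verit) exp_le_cancel_iff)
    have "Y \<le> \<rho>" "\<rho> \<le> X" using x assms(1) by (auto simp: X_def Y_def field_simps)
    then have "Y \<le> X" by simp
    note sgn = objective_partial_deriv_sign[OF Y this assms(4)]
    define D where "D = X * (odd_sum 1 n X - even_sum 1 n X) * (1 + even_sum 0 n Y - odd_sum 0 n Y) - (1 + even_sum 0 n X - odd_sum 0 n X) * (Y * (odd_sum 1 n Y - even_sum 1 n Y))
       + 2 * (X * odd_sum 1 n X) * odd_sum 0 n Y - 2 * odd_sum 0 n X * (Y * odd_sum 1 n Y)"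
    have "((\<lambda>s. objective_partial n (\<rho> * s) (\<rho> / s)) has_real_derivative D / x) (at x)"
    proof -
      \<comment> \<open>The inner derivatives are written as \<open>X / x\<close> and
        \<open>- Y / x\<close> so that \<open>1 / x\<close> factors out and leaves
        \<open>D\<close>.\<close>
      have "((\<lambda>s. \<rho> * s) has_real_derivative X / x) (at x)"
        by (rule derivative_eq_intros refl)+ (use x in \<open>simp add: X_def\<close>)
      note dX = DERIV_expsum[OF this, of _ 0 n, folded X_def]
      have "((\<lambda>s. \<rho> / s) has_real_derivative - Y / x) (at x)"
        by (rule derivative_eq_intros refl)+ (use x in \<open>auto simp: Y_def power2_eq_square\<close>)
      note dY = DERIV_expsum[OF this, of _ 0 n, folded Y_def]
      have TX: "((\<lambda>s. 1 + even_sum 0 n (\<rho> * s) - odd_sum 0 n (\<rho> * s)) has_real_derivative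
          (0 + - even_sum (Suc 0) n X * (X / x)) - (- odd_sum (Suc 0) n X * (X / x))) (at x)"
        by (intro DERIV_diff DERIV_add DERIV_const dX)
      have TY: "((\<lambda>s. 1 + even_sum 0 n (\<rho> / s) - odd_sum 0 n (\<rho> / s)) has_real_derivative
          (0 + - even_sum (Suc 0) n Y * (- Y / x)) - (- odd_sum (Suc 0) n Y * (- Y / x))) (at x)"
        by (intro DERIV_diff DERIV_add DERIV_const dY)
      show ?thesis
        unfolding objective_partial_def
        by (rule DERIV_cong[OF DERIV_diff[OF DERIV_mult[OF TX TY] DERIV_mult[OF DERIV_cmult[OF dX] dY]]])
           (use x in \<open>simp add: D_def X_def[symmetric] Y_def[symmetric] field_simps\<close>)
    qed
    moreover have "D / x \<le> 0" using sgn x by (simp add: D_def divide_nonpos_pos)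
    ultimately show "\<exists>y. ((\<lambda>s. objective_partial n (\<rho> * s) (\<rho> / s)) has_real_derivative y) (at x) \<and> y \<le> 0"
      by blast
  qed
  then show ?thesis by simp
qed


section \<open>Theta functions as limits of partial sums\<close>

text \<open>Unconditional summability gives the limit along any exhausting intervals; the loose
  bounds on \<open>a\<close> and \<open>b\<close> admit both windows used below, from
  \<open>- n\<close> to \<open>n - 1\<close> and from \<open>- 2 * n\<close> to
  \<open>2 * n\<close>.\<close>

lemma sum_symmetric_int_tendsto_infsum:
  fixes f :: "int \<Rightarrow> real"
  assumes f: "f summable_on UNIV" and a: "\<And>n. a n \<le> - int n" and b: "\<And>n. int n - 1 \<le> b n"
  shows "(\<lambda>n. \<Sum>k\<in>{a n..b n}. f k) \<longlonglongrightarrow> infsum f UNIV"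
proof -
  have "filterlim (\<lambda>n. {a n..b n}) (finite_subsets_at_top UNIV) sequentially"
    unfolding filterlim_finite_subsets_at_top
  proof (intro allI impI)
    fix A :: "int set" assume "finite A \<and> A \<subseteq> UNIV"
    then obtain m where m: "abs ` A \<subseteq> {..m}"
      using finite_int_iff_bounded_le[of A] by blast
    \<comment> \<open>The extra 1 is needed because the upper end is only known to reach
      \<open>n - 1\<close>.\<close>
    have "A \<subseteq> {a n..b n}" if "n \<ge> nat m + 1" for n
    proof
      fix k assume "k \<in> A"
      with m have "\<bar>k\<bar> \<le> m" by auto
      then show "k \<in> {a n..b n}" using a[of n] b[of n] that by auto
    qed
    then show "\<forall>\<^sub>F n in sequentially. finite {a n..b n} \<and> A \<subseteq> {a n..b n} \<and> {a n..b n} \<subseteq> UNIV"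
      by (auto intro!: eventually_sequentiallyI)
  qed
  moreover have "(sum f \<longlongrightarrow> infsum f UNIV) (finite_subsets_at_top UNIV)"
    using has_sum_infsum[OF f] by (simp add: has_sum_def)
  ultimately show ?thesis by (rule filterlim_compose[rotated])
qed

lemma summable_on_int_power_abs:
  fixes q :: real
  assumes "0 \<le> q" "q < 1"
  shows "(\<lambda>k::int. q ^ nat \<bar>k\<bar>) summable_on UNIV"
proof -
  have s: "(\<lambda>n. q ^ n) summable_on A" for A :: "nat set"
    using assms by (intro summable_on_subset[OF norm_summable_imp_summable_on]) (auto simp: norm_power)
  have "(\<lambda>k::int. q ^ nat \<bar>k\<bar>) summable_on (int ` UNIV)"
    by (subst summable_on_reindex) (use s in \<open>auto simp: o_def\<close>)
  moreover have "(\<lambda>k::int. q ^ nat \<bar>k\<bar>) summable_on ((\<lambda>n. - int n) ` {1..})"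
    by (subst summable_on_reindex) (use s in \<open>auto simp: o_def inj_on_def\<close>)
  moreover have "range int \<inter> (\<lambda>n. - int n) ` {1..} = {}" by auto
  ultimately have "(\<lambda>k::int. q ^ nat \<bar>k\<bar>) summable_on (range int \<union> (\<lambda>n. - int n) ` {1..})"
    by (rule summable_on_Un_disjoint)
  moreover have "k \<in> range int \<union> (\<lambda>n. - int n) ` {1..}" for k :: int
  proof (cases "k \<ge> 0")
    case True
    then have "k = int (nat k)" by simp
    then show ?thesis by blast
  next
    case False
    then have "k = - int (nat (- k))" "nat (- k) \<in> {1..}" by auto
    then show ?thesis by blast
  qed
  then have "range int \<union> (\<lambda>n. - int n) ` {1..} = UNIV" by blast
  ultimately show ?thesis by simp
qed

text \<open>Comparison with a two-sided geometric series. Only the absolute value of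
  \<open>f\<close> is prescribed, so the alternating series of \<open>theta4\<close> is covered
  too.\<close>

lemma summable_on_gaussian_int:
  fixes c f :: "int \<Rightarrow> real"
  assumes "s > 0" "\<And>k. \<bar>of_int k\<bar> \<le> c k" "\<And>k. \<bar>f k\<bar> = exp (- (c k * s))"
  shows "f summable_on UNIV"
proof -
  have "(\<lambda>k::int. exp (- s) ^ nat \<bar>k\<bar>) summable_on UNIV"
    using assms(1) by (intro summable_on_int_power_abs) auto
  moreover have "norm (f k) \<le> exp (- s) ^ nat \<bar>k\<bar>" for k
  proof -
    have "exp (- (c k * s)) \<le> exp (- (\<bar>of_int k\<bar> * s))"
      using assms by (simp add: mult_right_mono)
    also have "\<dots> = exp (- s) ^ nat \<bar>k\<bar>"
      by (simp flip: exp_of_nat_mult)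
    finally show ?thesis using assms(3) by simp
  qed
  ultimately have "(\<lambda>k. norm (f k)) summable_on UNIV"
    by (rule summable_on_comparison_test) auto
  then show ?thesis by (rule abs_summable_summable)
qed

lemma abs_le_square_int: "\<bar>real_of_int k\<bar> \<le> (of_int k)\<^sup>2"
proof -
  have "\<bar>k\<bar> * 1 \<le> \<bar>k\<bar> * \<bar>k\<bar>"
  proof (cases "k = 0")
    case False
    then show ?thesis by (intro mult_left_mono) auto
  qed simp
  then have "\<bar>k\<bar> \<le> k\<^sup>2" by (simp add: power2_eq_square abs_mult[symmetric])
  then show ?thesis by (metis of_int_abs of_int_le_iff of_int_power)
qed

text \<open>The indices \<open>k\<close> and \<open>- k - 1\<close> give the same odd square, hence
  the window ending at \<open>n - 1\<close>.\<close>

lemma theta_o_partial: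
  "(\<Sum>k\<in>{- int n..int n - 1}. exp (- pi * (2 * of_int k + 1)^2 * s)) = odd_sum 0 n (pi * s)"
proof (induction n)
  case (Suc n)
  have "{- int (Suc n)..int (Suc n) - 1} = insert (- int n - 1) (insert (int n) {- int n..int n - 1})"
    by auto
  moreover have "(2 * real_of_int (- int n - 1) + 1)\<^sup>2 = (2 * real n + 1)\<^sup>2"
    by (simp add: power2_eq_square algebra_simps)
  ultimately show ?case using Suc by (simp add: expsum_def oddsq_def algebra_simps)
qed (simp add: expsum_def)

text \<open>The window up to \<open>2 * n\<close> contains exactly \<open>n\<close> odd and
  \<open>n\<close> positive even squares, so the same \<open>odd_sum 0 n\<close> appears here as for
  \<open>theta_o\<close>. Each induction step adds four terms.\<close>

lemma theta4_partial:
  "(\<Sum>k\<in>{- (2 * int n)..2 * int n}. (-1) powi k * exp (- pi * (of_int k)^2 * s))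
    = 1 + even_sum 0 n (pi * s) - odd_sum 0 n (pi * s)"
proof (induction n)
  case (Suc n)
  let ?f = "\<lambda>k::int. (-1) powi k * exp (- pi * (of_int k)^2 * s)"
  have "{- (2 * int (Suc n))..2 * int (Suc n)} = insert (- 2 * int n - 1) (insert (2 * int n + 1)
     (insert (- 2 * int n - 2) (insert (2 * int n + 2) {- (2 * int n)..2 * int n})))"
    by auto
  then have "sum ?f {- (2 * int (Suc n))..2 * int (Suc n)} = ?f (- 2 * int n - 1) + ?f (2 * int n + 1)
      + ?f (- 2 * int n - 2) + ?f (2 * int n + 2) + sum ?f {- (2 * int n)..2 * int n}"
    by simp
  also have "?f (- 2 * int n - 1) = - exp (- (oddsq n * (pi * s)))"
    by (auto simp: power_int_minus_left oddsq_def power2_eq_square algebra_simps)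
  also have "?f (2 * int n + 1) = - exp (- (oddsq n * (pi * s)))"
    by (auto simp: power_int_minus_left oddsq_def power2_eq_square algebra_simps)
  also have "?f (- 2 * int n - 2) = exp (- (evensq n * (pi * s)))"
    by (auto simp: power_int_minus_left evensq_def power2_eq_square algebra_simps)
  also have "?f (2 * int n + 2) = exp (- (evensq n * (pi * s)))"
    by (auto simp: power_int_minus_left evensq_def power2_eq_square algebra_simps)
  finally show ?case unfolding Suc by (simp add: expsum_def)
qed (simp add: expsum_def)

lemma theta_o_tendsto:
  assumes "s > 0"
  shows "(\<lambda>n. odd_sum 0 n (pi * s)) \<longlonglongrightarrow> theta_o s"
proof -
  have "\<bar>real_of_int k\<bar> \<le> (2 * of_int k + 1)\<^sup>2" for k
  proof -
    have "\<bar>k\<bar> \<le> \<bar>2 * k + 1\<bar>" by arith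
    then have "\<bar>real_of_int k\<bar> \<le> \<bar>real_of_int (2 * k + 1)\<bar>" by linarith
    then show ?thesis using abs_le_square_int[of "2 * k + 1"] by simp
  qed
  then have "(\<lambda>k::int. exp (- pi * (2 * of_int k + 1)^2 * s)) summable_on UNIV"
    using assms by (intro summable_on_gaussian_int[of "pi * s" "\<lambda>k. (2 * of_int k + 1)\<^sup>2"]) auto
  from sum_symmetric_int_tendsto_infsum[OF this, of "\<lambda>n. - int n" "\<lambda>n. int n - 1"]
  show ?thesis by (simp add: theta_o_partial[simplified] theta_o_def)
qed

lemma theta4_tendsto:
  assumes "s > 0"
  shows "(\<lambda>n. 1 + even_sum 0 n (pi * s) - odd_sum 0 n (pi * s)) \<longlonglongrightarrow> theta4 s"
proof -
  have "(\<lambda>k::int. (-1) powi k * exp (- pi * (of_int k)^2 * s)) summable_on UNIV"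
    using assms abs_le_square_int
    by (intro summable_on_gaussian_int[of "pi * s" "\<lambda>k. (of_int k)\<^sup>2"]) (auto simp: abs_mult power_int_abs[symmetric])
  from sum_symmetric_int_tendsto_infsum[OF this, of "\<lambda>n. - (2 * int n)" "\<lambda>n. 2 * int n"]
  show ?thesis unfolding theta4_partial theta4_def by simp
qed

section \<open>Bounds for theta4 and the large-nome case\<close>

lemma theta_bounds_small_nome:
  assumes "s > 0" "exp (- (pi * s)) \<le> 1/8"
  shows "theta4 s \<ge> 1 - 2.1 * exp (- (pi * s))" "theta_o s \<le> 2.1 * exp (- (pi * s))"
proof -
  have "1 + even_sum 0 n (pi * s) - odd_sum 0 n (pi * s) \<ge> 1 - 2.1 * exp (- (pi * s))" for n
    using odd_sum_upper[OF assms(2), of 0 n] even_sum_nonneg[of 0 n "pi * s"] by simp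
  then show "theta4 s \<ge> 1 - 2.1 * exp (- (pi * s))"
    by (intro LIMSEQ_le_const[OF theta4_tendsto[OF assms(1)]]) auto
  show "theta_o s \<le> 2.1 * exp (- (pi * s))"
    using odd_sum_upper[OF assms(2), of 0] by (intro LIMSEQ_le_const2[OF theta_o_tendsto[OF assms(1)]]) auto
qed

lemma theta_o_nonneg:
  assumes "s > 0"
  shows "theta_o s \<ge> 0"
  using odd_sum_nonneg by (intro LIMSEQ_le_const[OF theta_o_tendsto[OF assms]]) auto

text \<open>Pairing each odd square with the next even one leaves nonnegative differences for a nome
  in [0, 1], the form both upper bounds on \<open>theta4\<close> rely on.\<close>

lemma even_minus_odd_sum_eq_nome:
  "1 + even_sum 0 n X - odd_sum 0 n X = 1 - 2 * (\<Sum>k<n. exp (- X) ^ (2 * k + 1)\<^sup>2 - exp (- X) ^ (2 * k + 2)\<^sup>2)"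
proof -
  have "exp (- X) ^ (2 * k + 1)\<^sup>2 = exp (- (oddsq k * X))" "exp (- X) ^ (2 * k + 2)\<^sup>2 = exp (- (evensq k * X))" for k
    by (simp_all add: oddsq_def evensq_def add.commute flip: exp_of_nat_mult)
  then show ?thesis by (simp add: expsum_def sum_subtractf algebra_simps)
qed

text \<open>
  With \<open>d\<^sub>k = b ^ k\<^sup>2 - b ^ (k+1)\<^sup>2\<close> one has \<open>theta4 = 1 - 2 (d\<^sub>1 + d\<^sub>3 + ...)\<close>, and \<open>d\<^sub>2\<^sub>k\<^sub>+\<^sub>2 \<le> 2 d\<^sub>2\<^sub>k\<^sub>+\<^sub>1\<close>
  makes the odd-indexed terms at least a third of the telescoping sum \<open>d\<^sub>1 + d\<^sub>2 + ... = b\<close>.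
\<close>

lemma theta4_le_linear:
  assumes "s > 0"
  shows "theta4 s \<le> 1 - 2/3 * exp (- (pi * s))"
proof -
  define b where "b = exp (- (pi * s))"
  have b: "0 \<le> b" "b < 1" using assms by (auto simp: b_def)
  have step: "(b ^ (2 * k + 1)\<^sup>2 - b ^ (2 * k + 3)\<^sup>2) / 3 \<le> b ^ (2 * k + 1)\<^sup>2 - b ^ (2 * k + 2)\<^sup>2" for k
  proof -
    define m where "m = 4 * k + 3"
    have e: "(2 * k + 2)\<^sup>2 = (2 * k + 1)\<^sup>2 + m" "(2 * k + 3)\<^sup>2 = (2 * k + 2)\<^sup>2 + (m + 2)"
      by (auto simp: m_def power2_eq_square algebra_simps)
    \<comment> \<open>As \<open>m \<ge> 2\<close>, \<open>1 - b ^ (m + 2)\<close> is at most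
      \<open>1 - b ^ (2 * m)\<close>, which factors with \<open>1 - b ^ m\<close>; the cofactor is
      at most 2.\<close>
    have "b ^ (m + m) \<le> b ^ (m + 2)" using b by (intro power_decreasing) (auto simp: m_def)
    then have "1 - b ^ (m + 2) \<le> 1 - b ^ m * b ^ m" by (simp add: power_add)
    also have "\<dots> = (1 - b ^ m) * (1 + b ^ m)" by (simp add: algebra_simps)
    also have "\<dots> \<le> (1 - b ^ m) * 2" using b by (intro mult_left_mono) (auto simp: power_le_one)
    finally have "b ^ m * (1 - b ^ (m + 2)) \<le> 1 * ((1 - b ^ m) * 2)"
      using b by (intro mult_mono) (auto simp: power_le_one simp del: power_Suc)
    then have "b ^ (2 * k + 1)\<^sup>2 * (b ^ m * (1 - b ^ (m + 2))) \<le> b ^ (2 * k + 1)\<^sup>2 * ((1 - b ^ m) * 2)"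
      using b by (intro mult_left_mono) auto
    then show ?thesis unfolding e by (simp add: power_add field_simps)
  qed
  have tele: "(b - b ^ (2 * n + 1)\<^sup>2) / 3 \<le> (\<Sum>k<n. b ^ (2 * k + 1)\<^sup>2 - b ^ (2 * k + 2)\<^sup>2)" for n
  proof (induction n)
    case (Suc n)
    have "2 * Suc n + 1 = 2 * n + 3" by simp
    with Suc step[of n] show ?case by (simp only: sum.lessThan_Suc) (simp add: field_simps)
  qed simp
  have "1 + even_sum 0 n (pi * s) - odd_sum 0 n (pi * s) \<le> 1 - 2/3 * (b - b ^ (2 * n + 1)\<^sup>2)" for n
    unfolding even_minus_odd_sum_eq_nome b_def[symmetric] using tele[of n] by linarith
  moreover have "(\<lambda>n. 1 - 2/3 * (b - b ^ (2 * n + 1)\<^sup>2)) \<longlonglongrightarrow> 1 - 2/3 * (b - 0)"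
  proof (intro tendsto_intros)
    have "strict_mono (\<lambda>n. (2 * n + 1)\<^sup>2 :: nat)"
      by (rule strict_monoI) (simp add: power_strict_mono)
    from LIMSEQ_subseq_LIMSEQ[OF LIMSEQ_realpow_zero[OF b] this]
    show "(\<lambda>n. b ^ (2 * n + 1)\<^sup>2) \<longlonglongrightarrow> 0" by (simp add: o_def)
  qed
  ultimately have "theta4 s \<le> 1 - 2/3 * (b - 0)"
    by (intro LIMSEQ_le[OF theta4_tendsto[OF assms]]) auto
  then show ?thesis by (simp add: b_def)
qed

text \<open>Of the nonnegative differences only the first, \<open>b - b ^ 4\<close>, is
  kept.\<close>

lemma theta4_le_quartic:
  assumes "s > 0"
  shows "theta4 s \<le> 1 - 2 * exp (- (pi * s)) + 2 * exp (- (pi * s)) ^ 4"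
proof -
  define b where "b = exp (- (pi * s))"
  have b: "0 \<le> b" "b < 1" using assms by (auto simp: b_def)
  have "1 + even_sum 0 n (pi * s) - odd_sum 0 n (pi * s) \<le> 1 - 2 * b + 2 * b ^ 4" if "n \<ge> 1" for n
  proof -
    have "(\<Sum>k\<in>{0}. b ^ (2 * k + 1)\<^sup>2 - b ^ (2 * k + 2)\<^sup>2) \<le> (\<Sum>k<n. b ^ (2 * k + 1)\<^sup>2 - b ^ (2 * k + 2)\<^sup>2)"
      using that b by (intro sum_mono2) (auto intro!: power_decreasing power_mono)
    then have "b - b ^ 4 \<le> (\<Sum>k<n. b ^ (2 * k + 1)\<^sup>2 - b ^ (2 * k + 2)\<^sup>2)"
      by (simp add: numeral_2_eq_2[symmetric] del: sum.lessThan_Suc)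
    then show ?thesis unfolding even_minus_odd_sum_eq_nome b_def[symmetric] by linarith
  qed
  then show ?thesis
    unfolding b_def by (intro LIMSEQ_le_const2[OF theta4_tendsto[OF assms]]) auto
qed

text \<open>The two bounds complement each other. For a nome of at least 2/5 the linear one gives 1
  - 4/15 < 0.77; for nomes between 1/8 and 2/5 the quartic one gives at most 1 - 1.872/8 <
  0.77.\<close>

lemma theta4_le_if_nome_ge:
  assumes "s > 0" "exp (- (pi * s)) \<ge> 1/8"
  shows "theta4 s \<le> 0.77"
proof (cases "exp (- (pi * s)) \<ge> 2/5")
  case True
  then show ?thesis using theta4_le_linear[OF assms(1)] by simp
next
  case False
  define b where "b = exp (- (pi * s))"
  have "b * b ^ 3 \<le> b * (2/5) ^ 3"
    using False by (intro mult_left_mono power_mono) (auto simp: b_def)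
  moreover have "b * b ^ 3 = b ^ 4" by (simp add: power_numeral_reduce)
  ultimately have "b ^ 4 \<le> b * (8/125)" by (simp add: power_divide)
  then show ?thesis using theta4_le_quartic[OF assms(1)] assms(2)
    unfolding b_def[symmetric] by simp
qed

section \<open>The objective and its comparison with the diagonal\<close>

definition objective :: "real \<Rightarrow> real \<Rightarrow> real" where
  "objective x y = theta4 x * theta4 y - 2 * theta_o x * theta_o y"

lemma objective_partial_tendsto:
  assumes "x > 0" "y > 0"
  shows "(\<lambda>n. objective_partial n (pi * x) (pi * y)) \<longlonglongrightarrow> objective x y"
  unfolding objective_partial_def objective_def
  by (intro tendsto_intros theta4_tendsto theta_o_tendsto assms)

lemma exp_neg_pi_mult_le:
  assumes "x \<ge> 1"
  shows "exp (- (pi * x)) \<le> 1/20"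
proof -
  have "exp (1::real) ^ 3 \<ge> 2.718 ^ 3" using e_ge_2718 by (intro power_mono) auto
  moreover have "exp (3::real) = exp 1 ^ 3" using exp_of_nat_mult[of 3 "1::real"] by simp
  ultimately have "exp (3::real) \<ge> 20" by (simp add: power_numeral_reduce)
  moreover have "pi * x \<ge> 3 * 1" using pi_gt3 assms by (intro mult_mono) auto
  then have "exp 3 \<le> exp (pi * x)" by simp
  ultimately have "20 \<le> exp (pi * x)" by (rule order_trans)
  then show ?thesis by (simp add: exp_minus field_simps)
qed

text \<open>With 2.1/20 = 0.105 the value is at least 0.895^2 - 2 * 0.105^2 > 0.77.\<close>

lemma objective_diag_ge:
  assumes "r \<ge> 1"
  shows "objective r r \<ge> 0.77"
proof -
  have r: "r > 0" "exp (- (pi * r)) \<le> 1/8" using assms exp_neg_pi_mult_le[OF assms] by auto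
  have "theta4 r \<ge> 0.895" "theta_o r \<le> 0.105"
    using theta_bounds_small_nome[OF r] exp_neg_pi_mult_le[OF assms] by auto
  then have "0.895 * 0.895 \<le> theta4 r * theta4 r" "theta_o r * theta_o r \<le> 0.105 * 0.105"
    using theta_o_nonneg[OF r(1)] by (intro mult_mono; simp)+
  then show ?thesis by (simp add: objective_def)
qed

lemma objective_le_diag:
  assumes "r \<ge> 1" "s \<ge> 1"
  shows "objective (r * s) (r / s) \<le> objective r r"
proof (cases "exp (- (pi * (r / s))) \<le> 1/8")
  case True
  show ?thesis
  proof (rule LIMSEQ_le[OF objective_partial_tendsto objective_partial_tendsto])
    \<comment> \<open>Truncations count from \<open>n = 1\<close>, since the derivative bound needs
      the leading odd term.\<close>
    show "\<exists>N. \<forall>n\<ge>N. objective_partial n (pi * (r * s)) (pi * (r / s)) \<le> objective_partial n (pi * r) (pi * r)"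
      using objective_partial_le_diag[of "pi * r" s] True assms by (intro exI[of _ 1]) (auto simp: mult.assoc)
  qed (use assms in auto)
next
  case False
  have x: "r * s \<ge> 1" "r * s > 0" using assms mult_mono[of 1 r 1 s] by auto
  have y: "r / s > 0" using assms by auto
  \<comment> \<open>Here \<open>theta4 (r * s)\<close> lies in [0, 1] because
    \<open>r * s \<ge> 1\<close>, and the \<open>theta_o\<close> product only lowers the
    value.\<close>
  have "theta4 (r * s) * theta4 (r / s) \<le> theta4 (r * s) * 0.77"
  proof (rule mult_left_mono)
    show "theta4 (r / s) \<le> 0.77" using theta4_le_if_nome_ge[OF y] False by simp
    show "theta4 (r * s) \<ge> 0"
      using theta_bounds_small_nome(1)[of "r * s"] x exp_neg_pi_mult_le[OF x(1)] by simp
  qed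
  moreover have "theta4 (r * s) \<le> 1" using theta4_le_linear[OF x(2)] exp_ge_zero[of "- (pi * (r * s))"] by linarith
  moreover have "theta_o (r * s) * theta_o (r / s) \<ge> 0" using theta_o_nonneg x y by simp
  ultimately show ?thesis using objective_diag_ge[OF assms(1)] by (simp add: objective_def)
qed

theorem theorem6:
  fixes r :: real
  assumes "r \<ge> 1"
  shows "\<forall>s>0. theta4 (r * s) * theta4 (r / s) - 2 * theta_o (r * s) * theta_o (r / s)
           \<le> theta4 (r * 1) * theta4 (r / 1) - 2 * theta_o (r * 1) * theta_o (r / 1)"
proof (intro allI impI)
  fix s :: real assume s: "s > 0"
  have "objective (r * s) (r / s) \<le> objective r r"
  proof (cases "s \<ge> 1")
    case True
    then show ?thesis using objective_le_diag assms by blast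
  next
    case False
    \<comment> \<open>Replacing \<open>s\<close> by \<open>1 / s\<close> swaps the two arguments of
      the symmetric function \<open>objective\<close>.\<close>
    then have "objective (r * (1 / s)) (r / (1 / s)) \<le> objective r r" using s by (intro objective_le_diag assms) simp
    then show ?thesis by (simp add: objective_def mult.commute mult.left_commute)
  qed
  then show "theta4 (r * s) * theta4 (r / s) - 2 * theta_o (r * s) * theta_o (r / s)
           \<le> theta4 (r * 1) * theta4 (r / 1) - 2 * theta_o (r * 1) * theta_o (r / 1)"
    by (simp add: objective_def)
qed

end
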